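(* Let $(X_1,Y_1),\ldots,(X_n,Y_n)$ be random vectors in $\mathbb{R}^d\times\mathbb{R}$ with finite second moments (with no assumption on their dependence). Let $\hat\Gamma := n^{-1}\sum_{i=1}^n X_iY_i$, $\hat\Sigma := n^{-1}\sum_{i=1}^n X_iX_i^\top$ and $\Sigma := \mathbb{E}[\hat\Sigma]$, with $\Sigma$ invertible. For nonempty $M\subseteq\{1,\ldots,d\}$ let $\hat\beta_M$ be any minimizer of $\sum_{i=1}^n (Y_i - X_{i,M}^\top\theta)^2$ over $\theta\in\mathbb{R}^{|M|}$, let $\beta_M$ be the minimizer of $\sum_{i=1}^n \mathbb{E}[(Y_i - X_{i,M}^\top\theta)^2]$ over $\theta\in\mathbb{R}^{|M|}$, and let $$\mathcal{D}_M^\Sigma := \|\Sigma_M^{-1/2}\hat\Sigma_M\Sigma_M^{-1/2} - I_{|M|}\|_{op}.$$ Then for any (possibly random and data-dependent) nonempty $\hat M\subseteq\{1,\ldots,d\}$, $$\big\|\hat\beta_{\hat M} - \beta_{\hat M} - \Sigma_{\hat M}^{-1}(\hat\Gamma_{\hat M} - \hat\Sigma_{\hat M}\beta_{\hat M})\big\|_{\Sigma_{\hat M}} \;\le\; \frac{\mathcal{D}^\Sigma_{\hat M}}{(1-\mathcal{D}^\Sigma_{\hat M})_+}\,\big\|\Sigma_{\hat M}^{-1}(\hat\Gamma_{\hat M} - \hat\Sigma_{\hat M}\beta_{\hat M})\big\|_{\Sigma_{\hat M}}.$$ More generally, simultaneously for all nonempty $M\subseteq\{1,\ldots,d\}$,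 $$\big\|\hat\beta_{M} - \beta_{M} - \Sigma_{M}^{-1}(\hat\Gamma_{M} - \hat\Sigma_{M}\beta_{M})\big\|_{\Sigma_{M}} \;\le\; \frac{\mathcal{D}^\Sigma_{M}}{(1-\mathcal{D}^\Sigma_{M})_+}\,\big\|\Sigma_{M}^{-1}(\hat\Gamma_{M} - \hat\Sigma_{M}\beta_{M})\big\|_{\Sigma_{M}}.$$
   Context: For a vector $v\in\mathbb{R}^d$ and $M\subseteq\{1,\ldots,d\}$, $v_M\in\mathbb{R}^{|M|}$ is the subvector of $v$ with indices in $M$ (and $X_{i,M}$ is that subvector of $X_i$); for a symmetric $d\times d$ matrix $A$, $A_M$ is the $|M|\times|M|$ submatrix with entries in $M\times M$. By contrast, $\hat\beta_M$ and $\beta_M$ are defined by the minimizations in the claim and are not subvectors of a full-model vector. For positive definite $A$, $\|x\|_A := \sqrt{x^\top A x}$ and $A^{1/2}$ is the symmetric square root; $\|\cdot\|_{op}$ is the operator norm induced by the Euclidean norm; $(t)_+ := \max\{0,t\}$. When $\mathcal{D}_M^\Sigma\ge 1$ the right-hand side is read as $+\infty$ (the bound is vacuous). *)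

theory Defs
  imports
    "HOL-Probability.Probability"
    "Jordan_Normal_Form.Gauss_Jordan_Elimination"
    "Jordan_Normal_Form.DL_Submatrix"
begin

unbundle no vec_syntax
no_notation inner (infix "\<bullet>" 70)

text \<open>
  Vectors and matrices are those of Jordan_Normal_Form, since the dimension \<open>|M|\<close> varies with
  (possibly random) \<open>M\<close>.  All indexing is 0-based: the coordinates of \<open>\<real>\<^sup>d\<close> are \<open>{..<d}\<close> and the
  observations are \<open>i < n\<close>.  Submatrices \<open>A\<^sub>M\<close> are \<open>submatrix A M M\<close>; subvectors list the indices in
  \<open>M\<close> in the same increasing order (\<open>pick M k\<close> is the \<open>k\<close>-th smallest element of \<open>M\<close>).
\<close>

definition subvec :: "real vec \<Rightarrow> nat set \<Rightarrow> real vec" where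
  "subvec v M = vec (card {i. i < dim_vec v \<and> i \<in> M}) (\<lambda>k. v $ pick M k)"

definition mat_inv :: "real mat \<Rightarrow> real mat" where
  "mat_inv A = the (mat_inverse A)"

definition eucl_norm :: "real vec \<Rightarrow> real" where
  "eucl_norm v = sqrt (v \<bullet> v)"

definition weighted_norm :: "real mat \<Rightarrow> real vec \<Rightarrow> real" where
  "weighted_norm A x = sqrt (x \<bullet> (A *\<^sub>v x))"

definition op_norm :: "real mat \<Rightarrow> real" where
  "op_norm A = (SUP x \<in> {x \<in> carrier_vec (dim_col A). eucl_norm x \<le> 1}. eucl_norm (A *\<^sub>v x))"

definition pos_semidef :: "real mat \<Rightarrow> bool" where
  "pos_semidef A \<longleftrightarrow> dim_row A = dim_col A \<and> A\<^sup>T = A \<and> (\<forall>x \<in> carrier_vec (dim_col A). 0 \<le> x \<bullet> (A *\<^sub>v x))"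

text \<open>
  The symmetric positive semidefinite square root; it exists and is unique when \<open>A\<close> is itself
  symmetric positive semidefinite.
\<close>

definition mat_sqrt :: "real mat \<Rightarrow> real mat" where
  "mat_sqrt A = (THE B. B \<in> carrier_mat (dim_row A) (dim_row A) \<and> pos_semidef B \<and> B * B = A)"

definition Gamma_hat :: "nat \<Rightarrow> nat \<Rightarrow> (nat \<Rightarrow> 'w \<Rightarrow> real vec) \<Rightarrow> (nat \<Rightarrow> 'w \<Rightarrow> real) \<Rightarrow> 'w \<Rightarrow> real vec" where
  "Gamma_hat d n X Y w = vec d (\<lambda>j. (\<Sum>i<n. X i w $ j * Y i w) / real n)"

definition Sigma_hat :: "nat \<Rightarrow> nat \<Rightarrow> (nat \<Rightarrow> 'w \<Rightarrow> real vec) \<Rightarrow> 'w \<Rightarrow> real mat" where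
  "Sigma_hat d n X w = mat d d (\<lambda>(j, k). (\<Sum>i<n. X i w $ j * X i w $ k) / real n)"

definition Sigma_pop :: "'w measure \<Rightarrow> nat \<Rightarrow> nat \<Rightarrow> (nat \<Rightarrow> 'w \<Rightarrow> real vec) \<Rightarrow> real mat" where
  "Sigma_pop P d n X = mat d d (\<lambda>(j, k). \<integral>w. Sigma_hat d n X w $$ (j, k) \<partial>P)"

definition is_beta_hat ::
  "nat \<Rightarrow> (nat \<Rightarrow> 'w \<Rightarrow> real vec) \<Rightarrow> (nat \<Rightarrow> 'w \<Rightarrow> real) \<Rightarrow> nat set \<Rightarrow> 'w \<Rightarrow> real vec \<Rightarrow> bool" where
  "is_beta_hat n X Y M w b \<longleftrightarrow>
     is_arg_min (\<lambda>\<theta>. \<Sum>i<n. (Y i w - subvec (X i w) M \<bullet> \<theta>)\<^sup>2) (\<lambda>\<theta>. \<theta> \<in> carrier_vec (card M)) b"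

definition is_beta ::
  "'w measure \<Rightarrow> nat \<Rightarrow> (nat \<Rightarrow> 'w \<Rightarrow> real vec) \<Rightarrow> (nat \<Rightarrow> 'w \<Rightarrow> real) \<Rightarrow> nat set \<Rightarrow> real vec \<Rightarrow> bool" where
  "is_beta P n X Y M b \<longleftrightarrow>
     is_arg_min (\<lambda>\<theta>. \<Sum>i<n. \<integral>w. (Y i w - subvec (X i w) M \<bullet> \<theta>)\<^sup>2 \<partial>P) (\<lambda>\<theta>. \<theta> \<in> carrier_vec (card M)) b"

text \<open>
  In the next two definitions \<open>S\<close>, \<open>Sh\<close> and \<open>Gh\<close> stand for \<open>\<Sigma>\<close> and realised values of its empirical
  counterpart and of the empirical cross moment \<open>\<Gamma>\<close>.
\<close>

definition D_dev :: "real mat \<Rightarrow> real mat \<Rightarrow> nat set \<Rightarrow> real" where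
  "D_dev S Sh M =
     (let R = mat_inv (mat_sqrt (submatrix S M M))
      in op_norm (R * submatrix Sh M M * R - 1\<^sub>m (card M)))"

definition lin_term :: "real mat \<Rightarrow> real mat \<Rightarrow> real vec \<Rightarrow> nat set \<Rightarrow> real vec \<Rightarrow> real vec" where
  "lin_term S Sh Gh M b = mat_inv (submatrix S M M) *\<^sub>v (subvec Gh M - submatrix Sh M M *\<^sub>v b)"

text \<open>
  \<open>D / (1 - D)\<^sub>+ \<cdot> r\<close>, read as \<open>+\<infinity>\<close> for \<open>D \<ge> 1\<close>.  The case distinction is needed because
  \<open>\<infinity> * 0 = 0\<close> in the extended reals, so that a plain product would be \<open>0\<close> for \<open>r = 0\<close>.
\<close>

definition ratio_bound :: "real \<Rightarrow> real \<Rightarrow> ereal" where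
  "ratio_bound D r = (if D \<ge> 1 then \<infinity> else ereal (D / max 0 (1 - D) * r))"

end

theory Submission
  imports Defs "Jordan_Normal_Form.Determinant"
begin

text \<open>
  Write \<open>A\<close>, \<open>B\<close> for \<open>\<Sigma>\<^sub>M\<close> and its empirical counterpart, \<open>u\<close> for the error of the least squares
  estimator and \<open>S = A\<^sup>1\<^sup>/\<^sup>2\<close>.  The normal equations turn the linear term into \<open>r = A\<^sup>-\<^sup>1 B u\<close>.  With
  \<open>E = S\<^sup>-\<^sup>1 B S\<^sup>-\<^sup>1 - 1\<close> this says \<open>S r = S u + E (S u)\<close>, so that \<open>u - r\<close> has norm
  \<open>\<parallel>E (S u)\<parallel> \<le> D \<parallel>S u\<parallel>\<close>, while \<open>(1 - D) \<parallel>S u\<parallel> \<le> \<parallel>S r\<parallel>\<close>.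
  The square root of a positive definite matrix is obtained from the binomial series.
\<close>

subsection \<open>Euclidean and operator norms\<close>

lemma scalar_prod_self: "v \<bullet> v = (\<Sum>i<dim_vec v. (v $ i)\<^sup>2)" for v :: "real vec"
  by (simp add: scalar_prod_def power2_eq_square lessThan_atLeast0)

lemma scalar_prod_self_nonneg: "0 \<le> v \<bullet> v" for v :: "real vec"
  by (simp add: scalar_prod_self sum_nonneg)

lemma scalar_prod_self_eq_0_iff:
  fixes v :: "real vec"
  assumes "v \<in> carrier_vec n"
  shows "v \<bullet> v = 0 \<longleftrightarrow> v = 0\<^sub>v n"
  using assms by (auto simp: scalar_prod_self sum_nonneg_eq_0_iff)

lemma pos_semidef_one: "pos_semidef (1\<^sub>m n)"
  by (auto simp: pos_semidef_def scalar_prod_self_nonneg)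

lemma symmetric_scalar_prod:
  fixes A :: "'a :: comm_semiring_0 mat"
  assumes "A \<in> carrier_mat n n" "A\<^sup>T = A" "x \<in> carrier_vec n" "y \<in> carrier_vec n"
  shows "(A *\<^sub>v x) \<bullet> y = x \<bullet> (A *\<^sub>v y)"
  using transpose_vec_mult_scalar[OF assms(1) assms(4) assms(3)] assms(2) by simp

text \<open>For positive \<open>c\<close> the claim is the hypothesis at the minimiser
  \<open>t = - b / c\<close>; for \<open>c = 0\<close> an affine function bounded below must have
  slope zero. Cauchy-Schwarz and the least squares orthogonality both rest on this.\<close>

lemma quadratic_nonneg_imp_discriminant:
  fixes a b c :: real
  assumes nonneg: "\<And>t. 0 \<le> a + 2 * t * b + t\<^sup>2 * c" and "0 \<le> c"
  shows "b\<^sup>2 \<le> a * c"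
proof (cases "c = 0")
  case True
  have "b = 0"
  proof (rule ccontr)
    assume "b \<noteq> 0"
    \<comment> \<open>At this \<open>t\<close> the affine function takes the value -1.\<close>
    then show False
      using nonneg[of "- (a + 1) / (2 * b)"] True by (simp add: field_simps)
  qed
  then show ?thesis
    using True by simp
next
  case False
  then have "0 < c"
    using \<open>0 \<le> c\<close> by simp
  have "0 \<le> a + 2 * (- b / c) * b + (- b / c)\<^sup>2 * c"
    by (rule nonneg)
  also have "\<dots> = a - b\<^sup>2 / c"
    using \<open>0 < c\<close> by (simp add: field_simps power2_eq_square)
  finally show ?thesis
    using \<open>0 < c\<close> by (simp add: field_simps)
qed

text \<open>The form at \<open>x + t y\<close> is a nonnegative quadratic in \<open>t\<close>, and
  symmetry of \<open>A\<close> merges its two cross terms. The semidefinite version is what later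
  turns a trivial kernel into definiteness.\<close>

lemma pos_semidef_Cauchy_Schwarz:
  assumes A: "A \<in> carrier_mat n n" "pos_semidef A" and x: "x \<in> carrier_vec n" and y: "y \<in> carrier_vec n"
  shows "(x \<bullet> (A *\<^sub>v y))\<^sup>2 \<le> (x \<bullet> (A *\<^sub>v x)) * (y \<bullet> (A *\<^sub>v y))"
proof (rule quadratic_nonneg_imp_discriminant)
  have sym: "y \<bullet> (A *\<^sub>v x) = x \<bullet> (A *\<^sub>v y)"
  proof -
    have "y \<bullet> (A *\<^sub>v x) = (A *\<^sub>v y) \<bullet> x"
      using A x y by (subst symmetric_scalar_prod) (auto simp: pos_semidef_def)
    also have "\<dots> = x \<bullet> (A *\<^sub>v y)"
      using A x y by (intro comm_scalar_prod) auto
    finally show ?thesis .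
  qed
  fix t :: real
  have carr: "A *\<^sub>v x \<in> carrier_vec n" "A *\<^sub>v y \<in> carrier_vec n"
    using A x y by auto
  have "0 \<le> (x + t \<cdot>\<^sub>v y) \<bullet> (A *\<^sub>v (x + t \<cdot>\<^sub>v y))"
    using A x y by (auto simp: pos_semidef_def)
  also have "A *\<^sub>v (x + t \<cdot>\<^sub>v y) = A *\<^sub>v x + t \<cdot>\<^sub>v (A *\<^sub>v y)"
    using A x y by (simp add: mult_add_distrib_mat_vec mult_mat_vec)
  also have "(x + t \<cdot>\<^sub>v y) \<bullet> (A *\<^sub>v x + t \<cdot>\<^sub>v (A *\<^sub>v y))
      = x \<bullet> (A *\<^sub>v x) + 2 * t * (x \<bullet> (A *\<^sub>v y)) + t\<^sup>2 * (y \<bullet> (A *\<^sub>v y))"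
    using x y carr sym
    by (simp add: add_scalar_prod_distrib[of _ n] scalar_prod_add_distrib[of _ n]
        algebra_simps power2_eq_square)
  finally show "0 \<le> x \<bullet> (A *\<^sub>v x) + 2 * t * (x \<bullet> (A *\<^sub>v y)) + t\<^sup>2 * (y \<bullet> (A *\<^sub>v y))" .
  show "0 \<le> y \<bullet> (A *\<^sub>v y)"
    using A y by (auto simp: pos_semidef_def)
qed

lemma scalar_prod_Cauchy_Schwarz:
  fixes x y :: "real vec"
  assumes "x \<in> carrier_vec n" "y \<in> carrier_vec n"
  shows "(x \<bullet> y)\<^sup>2 \<le> (x \<bullet> x) * (y \<bullet> y)"
  using pos_semidef_Cauchy_Schwarz[of "1\<^sub>m n" n x y] assms pos_semidef_one by simp

lemma eucl_norm_nonneg: "0 \<le> eucl_norm x"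
  by (simp add: eucl_norm_def scalar_prod_self_nonneg)

lemma eucl_norm_square: "(eucl_norm x)\<^sup>2 = x \<bullet> x"
  by (simp add: eucl_norm_def scalar_prod_self_nonneg)

lemma eucl_norm_eq_0_iff: "x \<in> carrier_vec n \<Longrightarrow> eucl_norm x = 0 \<longleftrightarrow> x = 0\<^sub>v n"
  by (simp add: eucl_norm_def scalar_prod_self_eq_0_iff)

lemma scalar_prod_le_eucl_norm:
  assumes "x \<in> carrier_vec n" "y \<in> carrier_vec n"
  shows "\<bar>x \<bullet> y\<bar> \<le> eucl_norm x * eucl_norm y"
  by (rule power2_le_imp_le)
    (use scalar_prod_Cauchy_Schwarz[OF assms] in
      \<open>simp_all add: power_mult_distrib eucl_norm_square eucl_norm_nonneg\<close>)

lemma eucl_norm_smult: "eucl_norm (c \<cdot>\<^sub>v x) = \<bar>c\<bar> * eucl_norm x"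
  by (simp add: eucl_norm_def scalar_prod_self power_mult_distrib sum_distrib_left[symmetric]
      real_sqrt_mult)

lemma eucl_norm_add_le:
  assumes "x \<in> carrier_vec n" "y \<in> carrier_vec n"
  shows "eucl_norm (x + y) \<le> eucl_norm x + eucl_norm y"
proof (rule power2_le_imp_le)
  have "(eucl_norm (x + y))\<^sup>2 = x \<bullet> x + 2 * (x \<bullet> y) + y \<bullet> y"
    using assms comm_scalar_prod[OF assms]
    by (simp add: eucl_norm_square add_scalar_prod_distrib[of _ n] scalar_prod_add_distrib[of _ n])
  also have "\<dots> \<le> (eucl_norm x + eucl_norm y)\<^sup>2"
    using scalar_prod_le_eucl_norm[OF assms] by (simp add: power2_sum eucl_norm_square)
  finally show "(eucl_norm (x + y))\<^sup>2 \<le> (eucl_norm x + eucl_norm y)\<^sup>2" .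
qed (simp add: eucl_norm_nonneg)

lemma abs_vec_index_le_eucl_norm:
  assumes "i < dim_vec x"
  shows "\<bar>x $ i\<bar> \<le> eucl_norm x"
proof (rule power2_le_imp_le)
  have "(x $ i)\<^sup>2 \<le> (\<Sum>i<dim_vec x. (x $ i)\<^sup>2)"
    using assms by (intro member_le_sum) auto
  then show "\<bar>x $ i\<bar>\<^sup>2 \<le> (eucl_norm x)\<^sup>2"
    by (simp add: eucl_norm_square scalar_prod_self)
qed (rule eucl_norm_nonneg)

text \<open>Cauchy-Schwarz on each row bounds the image by the Frobenius norm. Adding 1 under the
  root keeps the constant positive for the zero matrix too, so that it can be divided by.\<close>

lemma mult_mat_vec_bounded:
  obtains K where "0 < K" "\<And>x. x \<in> carrier_vec (dim_col A) \<Longrightarrow> eucl_norm (A *\<^sub>v x) \<le> K * eucl_norm x"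
proof
  let ?K2 = "\<Sum>i<dim_row A. row A i \<bullet> row A i"
  have K2: "0 \<le> ?K2"
    by (simp add: sum_nonneg scalar_prod_self_nonneg)
  show "0 < sqrt (?K2 + 1)"
    using K2 by simp
  fix x :: "real vec"
  assume x: "x \<in> carrier_vec (dim_col A)"
  show "eucl_norm (A *\<^sub>v x) \<le> sqrt (?K2 + 1) * eucl_norm x"
  proof (rule power2_le_imp_le)
    have "(eucl_norm (A *\<^sub>v x))\<^sup>2 = (\<Sum>i<dim_row A. (row A i \<bullet> x)\<^sup>2)"
      by (simp add: eucl_norm_square scalar_prod_self)
    also have "\<dots> \<le> (\<Sum>i<dim_row A. (row A i \<bullet> row A i) * (x \<bullet> x))"
      using x by (intro sum_mono scalar_prod_Cauchy_Schwarz[of _ "dim_col A"]) auto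
    also have "\<dots> = ?K2 * (x \<bullet> x)"
      by (simp only: sum_distrib_right)
    also have "\<dots> \<le> (?K2 + 1) * (x \<bullet> x)"
      by (intro mult_right_mono) (simp_all add: scalar_prod_self_nonneg)
    also have "\<dots> = (sqrt (?K2 + 1) * eucl_norm x)\<^sup>2"
      using K2 by (simp add: power_mult_distrib eucl_norm_square)
    finally show "(eucl_norm (A *\<^sub>v x))\<^sup>2 \<le> (sqrt (?K2 + 1) * eucl_norm x)\<^sup>2" .
  qed (use K2 in \<open>simp add: eucl_norm_nonneg\<close>)
qed

text \<open>A supremum of reals is an upper bound only if the set is bounded, so every use of
  \<open>op_norm\<close> goes through this.\<close>

lemma op_norm_bdd_above:
  "bdd_above ((\<lambda>x. eucl_norm (A *\<^sub>v x)) ` {x \<in> carrier_vec (dim_col A). eucl_norm x \<le> 1})"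
proof -
  obtain K where K: "0 < K" "\<And>x. x \<in> carrier_vec (dim_col A) \<Longrightarrow> eucl_norm (A *\<^sub>v x) \<le> K * eucl_norm x"
    using mult_mat_vec_bounded[of A] by blast
  show ?thesis
    by (rule bdd_aboveI2[where M = K])
      (use K in \<open>force intro: order_trans mult_left_mono[of _ 1 K, simplified]\<close>)
qed

lemma eucl_norm_zero: "eucl_norm (0\<^sub>v n) = 0"
  by (simp add: eucl_norm_def)

text \<open>Both sides are homogeneous in \<open>x\<close>, so scaling to a unit vector reduces the
  claim to the supremum; the zero vector cannot be scaled and is treated apart.\<close>

lemma eucl_norm_mult_le_op_norm:
  assumes x: "x \<in> carrier_vec (dim_col A)"
  shows "eucl_norm (A *\<^sub>v x) \<le> op_norm A * eucl_norm x"
proof (cases "eucl_norm x = 0")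
  case True
  then have "x = 0\<^sub>v (dim_col A)"
    using x by (simp add: eucl_norm_eq_0_iff)
  then have "A *\<^sub>v x = 0\<^sub>v (dim_row A)"
    by (intro eq_vecI) auto
  then show ?thesis
    using True by (simp add: eucl_norm_zero)
next
  case False
  then have pos: "0 < eucl_norm x"
    using eucl_norm_nonneg[of x] by simp
  let ?y = "(1 / eucl_norm x) \<cdot>\<^sub>v x"
  have "eucl_norm (A *\<^sub>v ?y) \<le> op_norm A"
    unfolding op_norm_def using x pos
    by (intro cSUP_upper op_norm_bdd_above) (auto simp: eucl_norm_smult)
  moreover have "A *\<^sub>v ?y = (1 / eucl_norm x) \<cdot>\<^sub>v (A *\<^sub>v x)"
    using x by (intro mult_mat_vec[of A "dim_row A"]) auto
  ultimately show ?thesis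
    using pos by (simp add: eucl_norm_smult field_simps)
qed

lemma op_norm_nonneg: "0 \<le> op_norm A"
proof -
  have "eucl_norm (A *\<^sub>v 0\<^sub>v (dim_col A)) \<le> op_norm A"
    unfolding op_norm_def by (intro cSUP_upper op_norm_bdd_above) (auto simp: eucl_norm_zero)
  then show ?thesis
    using eucl_norm_nonneg order_trans by blast
qed

subsection \<open>Positive definite matrices\<close>

definition pos_def :: "real mat \<Rightarrow> bool" where
  "pos_def A \<longleftrightarrow> pos_semidef A \<and>
     (\<forall>x \<in> carrier_vec (dim_col A). x \<bullet> (A *\<^sub>v x) = 0 \<longrightarrow> x = 0\<^sub>v (dim_col A))"

text \<open>Cauchy-Schwarz for the pair \<open>A x\<close>, \<open>x\<close> bounds the fourth power
  of the norm of \<open>A x\<close> by a multiple of the form at \<open>x\<close>. A zero of the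
  form therefore lies in the kernel of \<open>A\<close>.\<close>

lemma pos_semidef_nonsingular_imp_pos_def:
  assumes A: "A \<in> carrier_mat n n" "pos_semidef A"
    and ker: "\<And>x. x \<in> carrier_vec n \<Longrightarrow> A *\<^sub>v x = 0\<^sub>v n \<Longrightarrow> x = 0\<^sub>v n"
  shows "pos_def A"
  unfolding pos_def_def
proof (intro conjI ballI impI)
  fix x :: "real vec"
  assume x: "x \<in> carrier_vec (dim_col A)" and 0: "x \<bullet> (A *\<^sub>v x) = 0"
  have "x \<in> carrier_vec n" "A *\<^sub>v x \<in> carrier_vec n"
    using A x by auto
  then have "((A *\<^sub>v x) \<bullet> (A *\<^sub>v x))\<^sup>2 \<le> 0"
    using pos_semidef_Cauchy_Schwarz[OF A, of "A *\<^sub>v x" x] 0 by simp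
  then have "A *\<^sub>v x = 0\<^sub>v n"
    using \<open>A *\<^sub>v x \<in> carrier_vec n\<close> by (simp add: scalar_prod_self_eq_0_iff)
  then show "x = 0\<^sub>v (dim_col A)"
    using ker \<open>x \<in> carrier_vec n\<close> A by auto
qed (rule A)

text \<open>Definiteness gives a trivial kernel, hence a nonzero determinant, so
  \<open>mat_inverse\<close> succeeds and the \<open>the\<close> in \<open>mat_inv\<close> is
  meaningful.\<close>

lemma mat_inv_pos_def:
  assumes A: "A \<in> carrier_mat n n" and pd: "pos_def A"
  shows "mat_inv A \<in> carrier_mat n n" "A * mat_inv A = 1\<^sub>m n" "mat_inv A * A = 1\<^sub>m n"
proof -
  have "x = 0\<^sub>v n" if "x \<in> carrier_vec n" "A *\<^sub>v x = 0\<^sub>v n" for x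
    using that pd A by (auto simp: pos_def_def)
  then have "Determinant.det A \<noteq> 0"
    using det_0_iff_vec_prod_zero[OF A] by blast
  then have "A \<in> Units (ring_mat TYPE(real) n ())"
    by (rule det_non_zero_imp_unit[OF A])
  then obtain B where "mat_inverse A = Some B"
    using mat_inverse(1)[OF A, of "()"] by (cases "mat_inverse A") auto
  then show "mat_inv A \<in> carrier_mat n n" "A * mat_inv A = 1\<^sub>m n" "mat_inv A * A = 1\<^sub>m n"
    using mat_inverse(2)[OF A] by (simp_all add: mat_inv_def)
qed

text \<open>Replaces the smallest eigenvalue without spectral theory. Cauchy-Schwarz for
  \<open>x\<close> and \<open>y = A^-1 x\<close>, where \<open>A y = x\<close>, bounds the square of
  \<open>x \<bullet> x\<close> by the form at \<open>x\<close> times \<open>y \<bullet> x\<close>; a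
  bound \<open>K\<close> for the inverse then gives the constant \<open>1 / K\<close>.\<close>

lemma pos_def_coercive:
  assumes A: "A \<in> carrier_mat n n" and pd: "pos_def A"
  obtains l where "0 < l" "\<And>x. x \<in> carrier_vec n \<Longrightarrow> l * (x \<bullet> x) \<le> x \<bullet> (A *\<^sub>v x)"
proof -
  note inv = mat_inv_pos_def[OF A pd]
  have psd: "pos_semidef A"
    using pd by (simp add: pos_def_def)
  obtain K where K: "0 < K"
    "\<And>x. x \<in> carrier_vec (dim_col (mat_inv A)) \<Longrightarrow> eucl_norm (mat_inv A *\<^sub>v x) \<le> K * eucl_norm x"
    using mult_mat_vec_bounded[of "mat_inv A"] by blast
  show ?thesis
  proof
    show "0 < 1 / K"
      using K by simp
    fix x :: "real vec"
    assume x: "x \<in> carrier_vec n"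
    let ?y = "mat_inv A *\<^sub>v x"
    have y: "?y \<in> carrier_vec n"
      using inv x by auto
    have Ay: "A *\<^sub>v ?y = x"
      using inv x A by (simp flip: assoc_mult_mat_vec)
    show "1 / K * (x \<bullet> x) \<le> x \<bullet> (A *\<^sub>v x)"
    proof (cases "x \<bullet> x = 0")
      case True
      then show ?thesis
        using psd x A by (auto simp: pos_semidef_def)
    next
      case False
      then have pos: "0 < x \<bullet> x"
        using scalar_prod_self_nonneg[of x] by simp
      have nn: "0 \<le> x \<bullet> (A *\<^sub>v x)"
        using psd x A by (auto simp: pos_semidef_def)
      have "?y \<bullet> x \<le> eucl_norm ?y * eucl_norm x"
        using scalar_prod_le_eucl_norm[OF y x] by simp
      also have "\<dots> \<le> K * eucl_norm x * eucl_norm x"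
        using K(2)[of x] x inv by (intro mult_right_mono) (auto simp: eucl_norm_nonneg)
      also have "\<dots> = K * (x \<bullet> x)"
        by (simp flip: eucl_norm_square add: power2_eq_square)
      finally have yx: "?y \<bullet> x \<le> K * (x \<bullet> x)" .
      have "(x \<bullet> x)\<^sup>2 \<le> (x \<bullet> (A *\<^sub>v x)) * (?y \<bullet> x)"
        using pos_semidef_Cauchy_Schwarz[OF A psd x y] Ay by simp
      also have "\<dots> \<le> (x \<bullet> (A *\<^sub>v x)) * (K * (x \<bullet> x))"
        using yx nn by (rule mult_left_mono)
      finally have "x \<bullet> x \<le> (x \<bullet> (A *\<^sub>v x)) * K"
        using pos by (simp add: power2_eq_square)
      then show ?thesis
        using K(1) by (simp add: field_simps)
    qed
  qed
qed

subsection \<open>The positive semidefinite square root\<close>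

lemma mult_mat_index_sum:
  assumes "A \<in> carrier_mat n m" "B \<in> carrier_mat m k" "i < n" "j < k"
  shows "(A * B) $$ (i, j) = (\<Sum>l<m. A $$ (i, l) * B $$ (l, j))"
  using assms by (simp add: scalar_prod_def lessThan_atLeast0)

lemma mult_mat_vec_index_sum:
  assumes "A \<in> carrier_mat n m" "x \<in> carrier_vec m" "i < n"
  shows "(A *\<^sub>v x) $ i = (\<Sum>l<m. A $$ (i, l) * x $ l)"
  using assms by (simp add: scalar_prod_def lessThan_atLeast0)

lemma mult_mat_vec_zero:
  "A \<in> carrier_mat n m \<Longrightarrow> A *\<^sub>v 0\<^sub>v m = 0\<^sub>v n" for A :: "'a :: semiring_0 mat"
  by (intro eq_vecI) auto

section \<open>Matrix powers and the binomial series\<close>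

lemma pow_mat_index_add:
  fixes A :: "'a :: semiring_1 mat"
  assumes A: "A \<in> carrier_mat n n" and "i < n" "j < n"
  shows "(\<Sum>l<n. (A ^\<^sub>m a) $$ (i, l) * (A ^\<^sub>m b) $$ (l, j)) = (A ^\<^sub>m (a + b)) $$ (i, j)"
proof -
  have "A ^\<^sub>m (a + b) = A ^\<^sub>m a * A ^\<^sub>m b"
    using A by (induction b) (auto simp: assoc_mult_mat[of _ n n _ n _ n])
  then show ?thesis
    using assms mult_mat_index_sum[of "A ^\<^sub>m a" n n "A ^\<^sub>m b" n i j] by simp
qed

text \<open>Iterating the contraction bounds the norm of \<open>N^k x\<close> by \<open>q^k\<close>
  times that of \<open>x\<close>; the entry in question is coordinate \<open>i\<close> of
  \<open>N^k\<close> applied to the \<open>j\<close>-th unit vector.\<close>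

lemma pow_mat_contraction_index_le:
  assumes N: "N \<in> carrier_mat n n" and "0 \<le> q"
    and contr: "\<And>x. x \<in> carrier_vec n \<Longrightarrow> eucl_norm (N *\<^sub>v x) \<le> q * eucl_norm x"
    and ij: "i < n" "j < n"
  shows "\<bar>(N ^\<^sub>m k) $$ (i, j)\<bar> \<le> q ^ k"
proof -
  have *: "eucl_norm (N ^\<^sub>m k *\<^sub>v x) \<le> q ^ k * eucl_norm x" if "x \<in> carrier_vec n" for x
    using that
  proof (induction k arbitrary: x)
    case (Suc k)
    have "N ^\<^sub>m Suc k *\<^sub>v x = N ^\<^sub>m k *\<^sub>v (N *\<^sub>v x)"
      using N Suc.prems by (simp add: assoc_mult_mat_vec[of _ n n _ n])
    also have "eucl_norm \<dots> \<le> q ^ k * eucl_norm (N *\<^sub>v x)"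
      using N Suc.prems by (intro Suc.IH) auto
    also have "\<dots> \<le> q ^ k * (q * eucl_norm x)"
      using contr[OF Suc.prems] \<open>0 \<le> q\<close> by (intro mult_left_mono) auto
    finally show ?case
      by (simp add: mult_ac)
  qed (use N in auto)
  have e: "eucl_norm (unit_vec n j) = 1"
    using ij by (simp add: eucl_norm_def)
  have "(N ^\<^sub>m k) $$ (i, j) = (N ^\<^sub>m k *\<^sub>v unit_vec n j) $ i"
    using N ij by simp
  also have "\<bar>\<dots>\<bar> \<le> eucl_norm (N ^\<^sub>m k *\<^sub>v unit_vec n j)"
    using N ij by (intro abs_vec_index_le_eucl_norm) auto
  also have "\<dots> \<le> q ^ k"
    using *[of "unit_vec n j"] e by simp
  finally show ?thesis .
qed

text \<open>The real power \<open>(1 + N)^a\<close>. Summing entrywise reduces convergence to that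
  of real series.\<close>

definition binomial_mat :: "nat \<Rightarrow> real mat \<Rightarrow> real \<Rightarrow> real mat" where
  "binomial_mat n N a = mat n n (\<lambda>(i, j). \<Sum>k. (a gchoose k) * (N ^\<^sub>m k) $$ (i, j))"

lemma binomial_mat_carrier [simp]: "binomial_mat n N a \<in> carrier_mat n n"
  by (simp add: binomial_mat_def)

text \<open>The entries are dominated by the scalar binomial series at \<open>q\<close>, inside its
  disc of convergence. Absolute convergence is what Cauchy products require.\<close>

lemma binomial_mat_summable:
  assumes "N \<in> carrier_mat n n" "0 \<le> q" "q < 1"
    "\<And>x. x \<in> carrier_vec n \<Longrightarrow> eucl_norm (N *\<^sub>v x) \<le> q * eucl_norm x"
    "i < n" "j < n"
  shows "summable (\<lambda>k. norm ((a gchoose k) * (N ^\<^sub>m k) $$ (i, j)))"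
proof (rule summable_comparison_test')
  show "summable (\<lambda>k. norm ((a gchoose k) * q ^ k))"
    using assms by (intro abs_summable_in_conv_radius) (auto simp: conv_radius_gchoose)
  show "norm (norm ((a gchoose k) * (N ^\<^sub>m k) $$ (i, j))) \<le> norm ((a gchoose k) * q ^ k)" for k
    using pow_mat_contraction_index_le[OF assms(1,2,4-6), of k] \<open>0 \<le> q\<close>
    by (simp add: abs_mult mult_left_mono)
qed

text \<open>Vandermonde's identity makes \<open>a \<mapsto> (1 + N)\<^sup>a\<close> a one-parameter semigroup.\<close>

lemma binomial_mat_mult:
  assumes N: "N \<in> carrier_mat n n" "0 \<le> q" "q < 1"
    "\<And>x. x \<in> carrier_vec n \<Longrightarrow> eucl_norm (N *\<^sub>v x) \<le> q * eucl_norm x"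
  shows "binomial_mat n N a * binomial_mat n N b = binomial_mat n N (a + b)"
proof (rule eq_matI)
  fix i j
  assume "i < dim_row (binomial_mat n N (a + b))" "j < dim_col (binomial_mat n N (a + b))"
  then have ij: "i < n" "j < n"
    by (simp_all add: binomial_mat_def)
  let ?f = "\<lambda>a i j k. (a gchoose k) * (N ^\<^sub>m k) $$ (i, j)"
  \<comment> \<open>An entry of the product is a finite sum over \<open>l\<close> of products of two
    series, each of which becomes a Cauchy product.\<close>
  have "(\<lambda>k. \<Sum>l<n. \<Sum>m\<le>k. ?f a i l m * ?f b l j (k - m)) sums
      (\<Sum>l<n. (\<Sum>k. ?f a i l k) * (\<Sum>k. ?f b l j k))"
    using ij by (intro sums_sum Cauchy_product_sums binomial_mat_summable[OF N]) auto
  also have "(\<lambda>k. \<Sum>l<n. \<Sum>m\<le>k. ?f a i l m * ?f b l j (k - m)) = ?f (a + b) i j"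
  proof
    fix k
    \<comment> \<open>Summing over \<open>l\<close> first recombines the powers \<open>m\<close> and
      \<open>k - m\<close> into \<open>N^k\<close>, leaving Vandermonde's convolution of the
      coefficients.\<close>
    have "(\<Sum>l<n. \<Sum>m\<le>k. ?f a i l m * ?f b l j (k - m))
        = (\<Sum>m\<le>k. (a gchoose m) * (b gchoose (k - m)) *
            (\<Sum>l<n. (N ^\<^sub>m m) $$ (i, l) * (N ^\<^sub>m (k - m)) $$ (l, j)))"
      by (subst sum.swap) (simp add: sum_distrib_left mult_ac)
    also have "\<dots> = (\<Sum>m\<le>k. (a gchoose m) * (b gchoose (k - m)) * (N ^\<^sub>m k) $$ (i, j))"
      using ij by (intro sum.cong) (auto simp: pow_mat_index_add[OF N(1)])
    also have "\<dots> = ?f (a + b) i j k"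
      by (simp flip: sum_distrib_right gbinomial_Vandermonde add: atLeast0AtMost)
    finally show "(\<Sum>l<n. \<Sum>m\<le>k. ?f a i l m * ?f b l j (k - m)) = ?f (a + b) i j k" .
  qed
  finally have "(\<Sum>k. ?f (a + b) i j k) = (\<Sum>l<n. (\<Sum>k. ?f a i l k) * (\<Sum>k. ?f b l j k))"
    by (simp add: sums_iff)
  then show "(binomial_mat n N a * binomial_mat n N b) $$ (i, j) = binomial_mat n N (a + b) $$ (i, j)"
    using ij by (simp add: mult_mat_index_sum[of _ n n _ n] del: index_mult_mat)
      (simp add: binomial_mat_def)
qed (simp_all add: binomial_mat_def)

text \<open>For exponent 1 the coefficients vanish beyond \<open>k = 1\<close>, so the series is a
  finite sum.\<close>

lemma binomial_mat_one:
  assumes N: "N \<in> carrier_mat n n"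
  shows "binomial_mat n N 1 = 1\<^sub>m n + N"
proof (rule eq_matI)
  fix i j
  assume "i < dim_row (1\<^sub>m n + N)" "j < dim_col (1\<^sub>m n + N)"
  then have ij: "i < n" "j < n"
    using N by auto
  have "((1 :: real) gchoose k) = 0" if "k \<notin> {0, 1}" for k
    using binomial_gbinomial[of 1 k, where 'a = real] that by (simp add: binomial_eq_0)
  then have "(\<Sum>k. (1 gchoose k) * (N ^\<^sub>m k) $$ (i, j)) = (\<Sum>k\<in>{0, 1}. (1 gchoose k) * (N ^\<^sub>m k) $$ (i, j))"
    by (intro suminf_finite) auto
  also have "\<dots> = (1\<^sub>m n + N) $$ (i, j)"
    using N ij by simp
  finally show "binomial_mat n N 1 $$ (i, j) = (1\<^sub>m n + N) $$ (i, j)"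
    using ij by (simp add: binomial_mat_def)
qed (use N in \<open>auto simp: binomial_mat_def\<close>)

lemma binomial_mat_symmetric:
  assumes N: "N \<in> carrier_mat n n" "N\<^sup>T = N"
  shows "(binomial_mat n N a)\<^sup>T = binomial_mat n N a"
proof (rule eq_matI)
  have "(N ^\<^sub>m k)\<^sup>T = N ^\<^sub>m k" for k
  proof (induction k)
    case (Suc k)
    \<comment> \<open>Transposing reverses the factors of \<open>N^k * N\<close>; commutation
      restores their order.\<close>
    have "N ^\<^sub>m k * N = N * N ^\<^sub>m k"
      using N by (induction k) (auto simp: assoc_mult_mat[of _ n n _ n _ n])
    then show ?case
      using Suc N by (simp add: transpose_mult[of _ n n _ n])
  qed (use N in auto)
  then have "(N ^\<^sub>m k) $$ (i, j) = (N ^\<^sub>m k) $$ (j, i)" if "i < n" "j < n" for i j k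
    using that N by (metis carrier_matD index_transpose_mat(1) pow_carrier_mat)
  then show "(binomial_mat n N a)\<^sup>T $$ (i, j) = binomial_mat n N a $$ (i, j)"
    if "i < dim_row (binomial_mat n N a)" "j < dim_col (binomial_mat n N a)" for i j
    using that by (simp add: binomial_mat_def)
qed (simp_all add: binomial_mat_def)

section \<open>Existence of the square root\<close>

lemma pos_semidef_square:
  assumes T: "T \<in> carrier_mat n n" "T\<^sup>T = T"
  shows "pos_semidef (T * T)"
  unfolding pos_semidef_def
proof (intro conjI ballI)
  show "(T * T)\<^sup>T = T * T"
    using T by (simp add: transpose_mult[of _ n n _ n])
  fix x :: "real vec"
  assume "x \<in> carrier_vec (dim_col (T * T))"
  then have x: "x \<in> carrier_vec n"
    using T by simp
  have "x \<bullet> (T * T *\<^sub>v x) = (T *\<^sub>v x) \<bullet> (T *\<^sub>v x)"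
    using T x by (simp add: symmetric_scalar_prod[of _ n] assoc_mult_mat_vec[of _ n n _ n])
  then show "0 \<le> x \<bullet> (T * T *\<^sub>v x)"
    by (simp add: scalar_prod_self_nonneg)
qed (use T in auto)

lemma smult_mat_mult_self:
  fixes M :: "'a :: comm_semiring_0 mat"
  assumes "M \<in> carrier_mat n n"
  shows "(c \<cdot>\<^sub>m M) * (c \<cdot>\<^sub>m M) = (c * c) \<cdot>\<^sub>m (M * M)"
  using assms by (intro eq_matI) (auto simp: mult.assoc)

text \<open>The scaling \<open>s\<close> makes \<open>N = A / s - 1\<close> a strict contraction, so that the binomial series of
  \<open>(1 + N)\<^sup>1\<^sup>/\<^sup>2\<close> converges; it is positive semidefinite as the square of \<open>(1 + N)\<^sup>1\<^sup>/\<^sup>4\<close>.\<close>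

lemma pos_def_sqrt_exists:
  assumes A: "A \<in> carrier_mat n n" and pd: "pos_def A"
  obtains B where "B \<in> carrier_mat n n" "pos_semidef B" "B * B = A"
proof -
  have sym: "A\<^sup>T = A"
    using pd by (simp add: pos_def_def pos_semidef_def)
  obtain l where l: "0 < l" "\<And>x. x \<in> carrier_vec n \<Longrightarrow> l * (x \<bullet> x) \<le> x \<bullet> (A *\<^sub>v x)"
    using pos_def_coercive[OF A pd] by blast
  obtain K where K: "0 < K" "\<And>x. x \<in> carrier_vec (dim_col A) \<Longrightarrow> eucl_norm (A *\<^sub>v x) \<le> K * eucl_norm x"
    using mult_mat_vec_bounded[of A] by blast
  \<comment> \<open>Chosen so that \<open>K\<^sup>2 \<le> l * s\<close>. Expanding the squared norm
    of \<open>N x\<close> then gives the factor \<open>l / s - 2 * l / s + 1 = 1 - l / s\<close>,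
    which is the square of \<open>q\<close>; it is nonnegative because
    \<open>l \<le> s\<close>.\<close>
  define s where "s = (K\<^sup>2 + l\<^sup>2) / l"
  define q where "q = sqrt (1 - l / s)"
  have s: "0 < s" "l \<le> s" "K\<^sup>2 \<le> l * s"
    using l(1) K(1) by (auto simp: s_def field_simps power2_eq_square add_pos_pos)
  have q: "0 \<le> q" "q < 1" "q\<^sup>2 = 1 - l / s"
    using s l(1) by (auto simp: q_def real_less_lsqrt field_simps)
  define N where "N = (1 / s) \<cdot>\<^sub>m A - 1\<^sub>m n"
  have N: "N \<in> carrier_mat n n"
    unfolding N_def by (rule minus_carrier_mat) simp
  have symN: "N\<^sup>T = N"
  proof (rule eq_matI)
    show "N\<^sup>T $$ (i, j) = N $$ (i, j)" if "i < dim_row N" "j < dim_col N" for i j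
    proof -
      have "i < n" "j < n"
        using that N by auto
      then have "A $$ (i, j) = A $$ (j, i)"
        using A sym by (metis carrier_matD index_transpose_mat(1))
      then show ?thesis
        using \<open>i < n\<close> \<open>j < n\<close> A by (auto simp: N_def)
    qed
  qed (use N in auto)
  have contr: "eucl_norm (N *\<^sub>v x) \<le> q * eucl_norm x" if x: "x \<in> carrier_vec n" for x
  proof (rule power2_le_imp_le)
    have Ax: "A *\<^sub>v x \<in> carrier_vec n"
      using A x by simp
    have "N *\<^sub>v x = (1 / s) \<cdot>\<^sub>v (A *\<^sub>v x) - x"
      using A x unfolding N_def by (subst minus_mult_distrib_mat_vec[of _ n n]) auto
    then have "(eucl_norm (N *\<^sub>v x))\<^sup>2
        = ((1 / s) \<cdot>\<^sub>v (A *\<^sub>v x) - x) \<bullet> ((1 / s) \<cdot>\<^sub>v (A *\<^sub>v x) - x)"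
      by (simp add: eucl_norm_square)
    also have "\<dots> = ((A *\<^sub>v x) \<bullet> (A *\<^sub>v x)) / s\<^sup>2 - 2 / s * (x \<bullet> (A *\<^sub>v x)) + x \<bullet> x"
      using x Ax comm_scalar_prod[OF x Ax]
      by (simp add: minus_scalar_prod_distrib[of _ n] scalar_prod_minus_distrib[of _ n] power2_eq_square)
    also have "\<dots> \<le> (l * s * (x \<bullet> x)) / s\<^sup>2 - 2 / s * (l * (x \<bullet> x)) + x \<bullet> x"
    proof (intro add_mono diff_mono divide_right_mono mult_left_mono l(2)[OF x])
      have "(A *\<^sub>v x) \<bullet> (A *\<^sub>v x) \<le> K\<^sup>2 * (x \<bullet> x)"
        using K(2)[of x] A x power_mono[of "eucl_norm (A *\<^sub>v x)" "K * eucl_norm x" 2]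
        by (simp add: eucl_norm_nonneg eucl_norm_square power_mult_distrib)
      also have "\<dots> \<le> l * s * (x \<bullet> x)"
        using s by (intro mult_right_mono) (auto simp: scalar_prod_self_nonneg)
      finally show "(A *\<^sub>v x) \<bullet> (A *\<^sub>v x) \<le> l * s * (x \<bullet> x)" .
    qed (use s in auto)
    also have "\<dots> = q\<^sup>2 * (x \<bullet> x)"
      unfolding q(3) using s by (simp add: field_simps power2_eq_square)
    finally show "(eucl_norm (N *\<^sub>v x))\<^sup>2 \<le> (q * eucl_norm x)\<^sup>2"
      using s by (simp add: power_mult_distrib eucl_norm_square)
  qed (simp add: q eucl_norm_nonneg)
  note bin = binomial_mat_mult[OF N q(1,2) contr]
  let ?B = "sqrt s \<cdot>\<^sub>m binomial_mat n N (1 / 2)"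
  let ?T = "sqrt (sqrt s) \<cdot>\<^sub>m binomial_mat n N (1 / 4)"
  show ?thesis
  proof
    show "?B \<in> carrier_mat n n"
      by simp
    have "?B = ?T * ?T"
      using bin[of "1 / 4" "1 / 4"] s
      by (simp add: smult_mat_mult_self[OF binomial_mat_carrier])
    moreover have "(c \<cdot>\<^sub>m M)\<^sup>T = c \<cdot>\<^sub>m M\<^sup>T" for c and M :: "real mat"
      by (intro eq_matI) auto
    then have "?T\<^sup>T = ?T"
      by (simp add: binomial_mat_symmetric[OF N symN])
    ultimately show "pos_semidef ?B"
      using pos_semidef_square[of ?T n] by simp
    have "?B * ?B = s \<cdot>\<^sub>m (1\<^sub>m n + N)"
      using bin[of "1 / 2" "1 / 2"] s
      by (simp add: smult_mat_mult_self[OF binomial_mat_carrier] binomial_mat_one[OF N])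
    also have "\<dots> = A"
      using A s by (intro eq_matI) (auto simp: N_def)
    finally show "?B * ?B = A" .
  qed
qed

section \<open>Uniqueness of the square root\<close>

lemma pos_def_of_square:
  assumes B: "B \<in> carrier_mat n n" "pos_semidef B" and pd: "pos_def (B * B)"
  shows "pos_def B"
proof (rule pos_semidef_nonsingular_imp_pos_def[OF B])
  fix x :: "real vec"
  assume x: "x \<in> carrier_vec n" and "B *\<^sub>v x = 0\<^sub>v n"
  \<comment> \<open>A kernel vector of \<open>B\<close> is a zero of the form of
    \<open>B * B\<close>, which is definite.\<close>
  then have "x \<bullet> ((B * B) *\<^sub>v x) = 0"
    using B by (simp add: assoc_mult_mat_vec[of _ n n _ n] mult_mat_vec_zero[of _ n n])
  then show "x = 0\<^sub>v n"
    using pd B x unfolding pos_def_def by simp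
qed

text \<open>With \<open>D = B - C\<close>, the trace of \<open>D (B + C) D\<close> is half the trace of
  \<open>D ((B + C) D + D (B + C)) = 2 D (B\<^sup>2 - C\<^sup>2) = 0\<close>.\<close>

lemma pos_def_sqrt_unique:
  assumes B: "B \<in> carrier_mat n n" "pos_semidef B" and C: "C \<in> carrier_mat n n" "pos_def C"
    and eq: "B * B = C * C"
  shows "B = C"
proof -
  define D where "D = B - C"
  define E where "E = B + C"
  have D: "D \<in> carrier_mat n n" and E: "E \<in> carrier_mat n n"
    using B C by (auto simp: D_def E_def)
  have C': "pos_semidef C"
    using C by (simp add: pos_def_def)
  have symD: "D\<^sup>T = D"
    using B C C' by (simp add: D_def pos_semidef_def transpose_minus[of _ n n])
  \<comment> \<open>The mixed products of \<open>B\<close> and \<open>C\<close> cancel in the sum,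
    leaving twice the difference of the squares.\<close>
  have ED: "E * D + D * E = 0\<^sub>m n n"
  proof -
    have "E * D = B * B - B * C + (C * B - C * C)" "D * E = B * B - C * B + (B * C - C * C)"
      using B C unfolding D_def E_def
      by (auto simp: add_mult_distrib_mat[of _ n n _ _ n] mult_minus_distrib_mat[of _ n n _ n]
          minus_mult_distrib_mat[of _ n n _ _ n] mult_add_distrib_mat[of _ n n _ n])
    moreover have "P - Q + (R - P) + (P - R + (Q - P)) = 0\<^sub>m n n"
      if "P \<in> carrier_mat n n" "Q \<in> carrier_mat n n" "R \<in> carrier_mat n n" for P Q R :: "real mat"
      using that by (intro eq_matI) auto
    ultimately show ?thesis
      using B C by (simp flip: eq)
  qed
  have quad: "col D i \<bullet> (E *\<^sub>v col D i) = (D * (E * D)) $$ (i, i)" if "i < n" for i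
  proof -
    have "row D i = col D i"
      using that D symD by (metis carrier_matD(2) row_transpose)
    then show ?thesis
      using that D E by (simp add: col_mult2[of _ n n _ n])
  qed
  \<comment> \<open>The form of \<open>E\<close> dominates that of \<open>C\<close>, because the
    difference is the form of the semidefinite \<open>B\<close>.\<close>
  have nonneg: "0 \<le> col D i \<bullet> (E *\<^sub>v col D i)"
      and le: "col D i \<bullet> (C *\<^sub>v col D i) \<le> col D i \<bullet> (E *\<^sub>v col D i)" if "i < n" for i
  proof -
    let ?x = "col D i"
    have x: "?x \<in> carrier_vec n"
      using that D by auto
    have "0 \<le> ?x \<bullet> (B *\<^sub>v ?x)" "0 \<le> ?x \<bullet> (C *\<^sub>v ?x)"
      using x B C C' unfolding pos_semidef_def by auto
    moreover have "?x \<bullet> (E *\<^sub>v ?x) = ?x \<bullet> (B *\<^sub>v ?x) + ?x \<bullet> (C *\<^sub>v ?x)"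
      using B C x unfolding E_def
      by (simp add: add_mult_distrib_mat_vec[of _ n n] scalar_prod_add_distrib[of _ n])
    ultimately show "0 \<le> ?x \<bullet> (E *\<^sub>v ?x)" "?x \<bullet> (C *\<^sub>v ?x) \<le> ?x \<bullet> (E *\<^sub>v ?x)"
      by auto
  qed
  \<comment> \<open>Replacing \<open>E * D\<close> by \<open>- (D * E)\<close> and moving a factor
    cyclically under the trace shows that the trace equals its own negative.\<close>
  have "(\<Sum>i<n. (D * (E * D)) $$ (i, i)) = (\<Sum>i<n. \<Sum>l<n. D $$ (i, l) * (E * D) $$ (l, i))"
    using D E by (intro sum.cong) (auto simp: mult_mat_index_sum[of _ n n _ n] simp del: index_mult_mat)
  also have "\<dots> = - (\<Sum>i<n. \<Sum>l<n. D $$ (i, l) * (D * E) $$ (l, i))"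
  proof -
    have "(E * D) $$ (l, i) = - (D * E) $$ (l, i)" if "l < n" "i < n" for l i
    proof -
      have "(E * D + D * E) $$ (l, i) = 0"
        using ED that by simp
      then show ?thesis
        using that D E by (simp del: index_mult_mat(1))
    qed
    then show ?thesis
      by (simp add: sum_negf)
  qed
  also have "(\<Sum>i<n. \<Sum>l<n. D $$ (i, l) * (D * E) $$ (l, i)) = (\<Sum>l<n. (D * E * D) $$ (l, l))"
    using D E by (subst sum.swap)
      (simp add: mult_mat_index_sum[of "D * E" n n D n] mult.commute
        del: index_mult_mat(1) assoc_mult_mat)
  also have "D * E * D = D * (E * D)"
    using D E by (simp add: assoc_mult_mat[of _ n n _ n _ n])
  finally have "(\<Sum>i<n. (D * (E * D)) $$ (i, i)) = 0"
    by simp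
  then have "(\<Sum>i<n. col D i \<bullet> (E *\<^sub>v col D i)) = 0"
    using quad by simp
  then have 0: "col D i \<bullet> (E *\<^sub>v col D i) = 0" if "i < n" for i
    using that nonneg
      sum_nonneg_eq_0_iff[of "{..<n}" "\<lambda>i. col D i \<bullet> (E *\<^sub>v col D i)"] by auto
  \<comment> \<open>A sum of nonnegative terms vanished, so each form of \<open>E\<close> is zero;
    the smaller form of the definite \<open>C\<close> is then zero as well.\<close>
  have "col D i = 0\<^sub>v n" if "i < n" for i
  proof -
    have x: "col D i \<in> carrier_vec n"
      using that D by auto
    have "0 \<le> col D i \<bullet> (C *\<^sub>v col D i)"
      using x C C' unfolding pos_semidef_def by auto
    then have "col D i \<bullet> (C *\<^sub>v col D i) = 0"
      using 0[OF that] le[OF that] by simp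
    then show ?thesis
      using C x by (auto simp: pos_def_def)
  qed
  then have Dz: "D $$ (i, j) = 0" if "i < n" "j < n" for i j
    using that D by (metis carrier_matD index_col index_zero_vec(1))
  show ?thesis
  proof (rule eq_matI)
    show "B $$ (i, j) = C $$ (i, j)" if "i < dim_row C" "j < dim_col C" for i j
      using Dz[of i j] that B C by (simp add: D_def)
  qed (use B C in auto)
qed

text \<open>Existence and uniqueness together discharge the \<open>THE\<close> in
  \<open>mat_sqrt\<close>. Any competitor is only semidefinite, so the definiteness of the
  constructed root carries the uniqueness argument.\<close>

lemma mat_sqrt_pos_def:
  assumes A: "A \<in> carrier_mat n n" and pd: "pos_def A"
  shows "mat_sqrt A \<in> carrier_mat n n" "pos_def (mat_sqrt A)" "mat_sqrt A * mat_sqrt A = A"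
proof -
  obtain B where B: "B \<in> carrier_mat n n" "pos_semidef B" "B * B = A"
    using pos_def_sqrt_exists[OF A pd] by blast
  have pdB: "pos_def B"
    using pos_def_of_square[OF B(1,2)] B(3) pd by simp
  have "mat_sqrt A = B"
    unfolding mat_sqrt_def
  proof (rule the_equality)
    show "B' = B" if "B' \<in> carrier_mat (dim_row A) (dim_row A) \<and> pos_semidef B' \<and> B' * B' = A" for B'
      by (rule pos_def_sqrt_unique[OF _ _ B(1) pdB]) (use that A B(3) in auto)
  qed (use A B in auto)
  then show "mat_sqrt A \<in> carrier_mat n n" "pos_def (mat_sqrt A)" "mat_sqrt A * mat_sqrt A = A"
    using B pdB by simp_all
qed

subsection \<open>Principal submatrices\<close>

text \<open>\<open>pick\<close> is strictly increasing into \<open>M\<close>, and an injective image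
  of the same finite cardinality is all of \<open>M\<close>. This allows reindexing sums over
  submatrix positions.\<close>

lemma bij_betw_pick:
  assumes "finite M"
  shows "bij_betw (pick M) {..<card M} M"
proof -
  have "inj_on (pick M) {..<card M}"
    by (rule linorder_inj_onI) (use pick_mono_le in force)+
  moreover have "pick M ` {..<card M} \<subseteq> M"
    using pick_in_set_le by auto
  ultimately show ?thesis
    using card_subset_eq[OF assms, of "pick M ` {..<card M}"] by (simp add: bij_betw_def card_image)
qed

lemma subvec_carrier:
  "v \<in> carrier_vec d \<Longrightarrow> M \<subseteq> {..<d} \<Longrightarrow> subvec v M \<in> carrier_vec (card M)"
  by (auto simp: subvec_def intro: arg_cong[where f = card])

lemma subvec_index:
  "v \<in> carrier_vec d \<Longrightarrow> M \<subseteq> {..<d} \<Longrightarrow> k < card M \<Longrightarrow> subvec v M $ k = v $ pick M k"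
  using subvec_carrier[of v d M] by (auto simp: subvec_def)

lemma submatrix_carrier:
  "A \<in> carrier_mat d d \<Longrightarrow> M \<subseteq> {..<d} \<Longrightarrow> submatrix A M M \<in> carrier_mat (card M) (card M)"
  by (auto simp: dim_submatrix intro!: carrier_matI arg_cong[where f = card])

lemma submatrix_index_pick:
  assumes "A \<in> carrier_mat d d" "M \<subseteq> {..<d}" "k < card M" "l < card M"
  shows "submatrix A M M $$ (k, l) = A $$ (pick M k, pick M l)"
  using submatrix_carrier[OF assms(1,2)] assms(3,4)
  by (intro submatrix_index) (auto simp: dim_submatrix)

lemma quadratic_form_sum:
  assumes "A \<in> carrier_mat n n" "x \<in> carrier_vec n"
  shows "x \<bullet> (A *\<^sub>v x) = (\<Sum>i<n. \<Sum>j<n. x $ i * A $$ (i, j) * x $ j)"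
proof -
  have "x \<bullet> (A *\<^sub>v x) = (\<Sum>i<n. x $ i * (A *\<^sub>v x) $ i)"
    using assms by (simp add: scalar_prod_def lessThan_atLeast0)
  also have "\<dots> = (\<Sum>i<n. \<Sum>j<n. x $ i * A $$ (i, j) * x $ j)"
    using assms by (intro sum.cong refl)
      (simp add: mult_mat_vec_index_sum[of A n n] sum_distrib_left mult.assoc del: index_mult_mat_vec)
  finally show ?thesis .
qed

text \<open>The form of the submatrix at \<open>z\<close> is the form of \<open>A\<close> at
  \<open>z\<close> padded with zeros outside \<open>M\<close>, so nonnegativity and definiteness are
  inherited.\<close>

lemma pos_def_submatrix:
  assumes A: "A \<in> carrier_mat d d" "pos_def A" and M: "M \<subseteq> {..<d}"
  shows "pos_def (submatrix A M M)"
proof -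
  note AM = submatrix_carrier[OF A(1) M]
  have fin: "finite M"
    using M finite_subset by blast
  note bij = bij_betw_pick[OF fin]
  have pick_less: "pick M k < d" if "k < card M" for k
    using bij_betw_apply[OF bij] that M by auto
  have psd: "pos_semidef A"
    using A by (simp add: pos_def_def)
  have sym: "(submatrix A M M)\<^sup>T = submatrix A M M"
  proof (rule eq_matI)
    show "(submatrix A M M)\<^sup>T $$ (k, l) = submatrix A M M $$ (k, l)"
      if "k < dim_row (submatrix A M M)" "l < dim_col (submatrix A M M)" for k l
    proof -
      have kl: "k < card M" "l < card M"
        using that AM by auto
      have "A $$ (pick M l, pick M k) = A\<^sup>T $$ (pick M k, pick M l)"
        using A kl pick_less by simp
      also have "A\<^sup>T = A"
        using psd by (simp add: pos_semidef_def)
      finally show ?thesis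
        using kl AM by (simp add: submatrix_index_pick[OF A(1) M])
    qed
  qed (use AM in auto)
  \<comment> \<open>Counting the elements of \<open>M\<close> below \<open>i\<close> inverts
    \<open>pick M\<close>, so \<open>z $ k\<close> lands at the \<open>k\<close>-th smallest index
    of \<open>M\<close>.\<close>
  define ext where "ext z = vec d (\<lambda>i. if i \<in> M then z $ card {a \<in> M. a < i} else 0)" for z :: "real vec"
  have ext: "ext z \<in> carrier_vec d" for z
    by (simp add: ext_def)
  have ext_pick: "ext z $ pick M k = z $ k" if "k < card M" for z k
    using that pick_less pick_in_set_le card_pick_le by (simp add: ext_def)
  have form: "z \<bullet> (submatrix A M M *\<^sub>v z) = ext z \<bullet> (A *\<^sub>v ext z)" if z: "z \<in> carrier_vec (card M)" for z
  proof -
    \<comment> \<open>Used twice below, first for the inner sum and then for the outer one.\<close>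
    have restrict: "(\<Sum>k<card M. f (pick M k)) = (\<Sum>i<d. f i)" if "\<And>i. i < d \<Longrightarrow> i \<notin> M \<Longrightarrow> f i = 0"
      for f :: "nat \<Rightarrow> real"
      unfolding sum.reindex_bij_betw[OF bij] using that M by (intro sum.mono_neutral_left) auto
    have ext0: "ext z $ i = 0" if "i < d" "i \<notin> M" for i
      using that by (simp add: ext_def)
    have "z \<bullet> (submatrix A M M *\<^sub>v z)
        = (\<Sum>k<card M. \<Sum>l<card M. ext z $ pick M k * A $$ (pick M k, pick M l) * ext z $ pick M l)"
      unfolding quadratic_form_sum[OF AM z]
      by (intro sum.cong refl) (simp add: ext_pick submatrix_index_pick[OF A(1) M])
    also have "\<dots> = (\<Sum>k<card M. \<Sum>j<d. ext z $ pick M k * A $$ (pick M k, j) * ext z $ j)"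
      by (intro sum.cong refl restrict) (simp add: ext0)
    also have "\<dots> = (\<Sum>i<d. \<Sum>j<d. ext z $ i * A $$ (i, j) * ext z $ j)"
      by (rule restrict) (simp add: ext0)
    also have "\<dots> = ext z \<bullet> (A *\<^sub>v ext z)"
      by (rule quadratic_form_sum[OF A(1) ext, symmetric])
    finally show ?thesis .
  qed
  show ?thesis
    unfolding pos_def_def pos_semidef_def
  proof (intro conjI ballI impI)
    show "dim_row (submatrix A M M) = dim_col (submatrix A M M)"
      using AM by auto
    show "0 \<le> z \<bullet> (submatrix A M M *\<^sub>v z)" if "z \<in> carrier_vec (dim_col (submatrix A M M))" for z
    proof -
      have "0 \<le> ext z \<bullet> (A *\<^sub>v ext z)"
        using psd ext A(1) unfolding pos_semidef_def by auto
      then show ?thesis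
        using that AM form by auto
    qed
    show "z = 0\<^sub>v (dim_col (submatrix A M M))"
      if "z \<in> carrier_vec (dim_col (submatrix A M M))" "z \<bullet> (submatrix A M M *\<^sub>v z) = 0" for z
    proof -
      have z: "z \<in> carrier_vec (card M)"
        using that AM by auto
      then have "ext z \<bullet> (A *\<^sub>v ext z) = 0"
        using that(2) form by simp
      then have "ext z = 0\<^sub>v d"
        using A ext unfolding pos_def_def by auto
      then have "z $ k = 0" if "k < card M" for k
        using ext_pick[OF that, of z] pick_less[OF that] by simp
      then show ?thesis
        using z AM by (intro eq_vecI) auto
    qed
  qed (rule sym)
qed

subsection \<open>Second moments and least squares\<close>

lemma Sigma_hat_carrier [simp]: "Sigma_hat d n X w \<in> carrier_mat d d"
  by (simp add: Sigma_hat_def)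

lemma Sigma_pop_carrier [simp]: "Sigma_pop P d n X \<in> carrier_mat d d"
  by (simp add: Sigma_pop_def)

lemma Gamma_hat_carrier [simp]: "Gamma_hat d n X Y w \<in> carrier_vec d"
  by (simp add: Gamma_hat_def)

text \<open>The form is the average of the squares of the scalar products of the observations with
  \<open>x\<close>. As a double sum over entries it can be integrated term by term.\<close>

lemma Sigma_hat_quadratic_form_nonneg:
  "0 \<le> (\<Sum>j<d. \<Sum>k<d. x $ j * Sigma_hat d n X w $$ (j, k) * x $ k)"
proof -
  have "(\<Sum>j<d. \<Sum>k<d. x $ j * Sigma_hat d n X w $$ (j, k) * x $ k)
      = (\<Sum>j<d. \<Sum>k<d. \<Sum>i<n. (X i w $ j * x $ j) * (X i w $ k * x $ k) / real n)"
    by (intro sum.cong refl) (simp add: Sigma_hat_def sum_distrib_left sum_distrib_right sum_divide_distrib mult_ac)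
  also have "\<dots> = (\<Sum>j<d. \<Sum>i<n. \<Sum>k<d. (X i w $ j * x $ j) * (X i w $ k * x $ k) / real n)"
    by (intro sum.cong refl sum.swap)
  also have "\<dots> = (\<Sum>i<n. \<Sum>j<d. \<Sum>k<d. (X i w $ j * x $ j) * (X i w $ k * x $ k) / real n)"
    by (rule sum.swap)
  also have "\<dots> = (\<Sum>i<n. (\<Sum>j<d. X i w $ j * x $ j)\<^sup>2 / real n)"
    unfolding power2_eq_square sum_product sum_divide_distrib ..
  also have "0 \<le> \<dots>"
    by (intro sum_nonneg) auto
  finally show ?thesis .
qed

text \<open>Each product of two coordinates is dominated by the sum of their squares, so finite
  second moments suffice.\<close>

lemma integrable_Sigma_hat_index:
  assumes meas: "\<And>i j. i < n \<Longrightarrow> j < d \<Longrightarrow> (\<lambda>w. X i w $ j) \<in> borel_measurable P"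
    and int: "\<And>i j. i < n \<Longrightarrow> j < d \<Longrightarrow> integrable P (\<lambda>w. (X i w $ j)\<^sup>2)"
    and jk: "j < d" "k < d"
  shows "integrable P (\<lambda>w. Sigma_hat d n X w $$ (j, k))"
proof -
  have "integrable P (\<lambda>w. X i w $ j * X i w $ k)" if "i < n" for i
  proof (rule Bochner_Integration.integrable_bound)
    show "integrable P (\<lambda>w. (X i w $ j)\<^sup>2 + (X i w $ k)\<^sup>2)"
      using that jk int by simp
    show "(\<lambda>w. X i w $ j * X i w $ k) \<in> borel_measurable P"
      using that jk meas by simp
    have "\<bar>a * b\<bar> \<le> a\<^sup>2 + b\<^sup>2" for a b :: real
    proof -
      have "2 * (\<bar>a\<bar> * \<bar>b\<bar>) \<le> a\<^sup>2 + b\<^sup>2"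
        using sum_squares_bound[of "\<bar>a\<bar>" "\<bar>b\<bar>"] by (simp add: mult.assoc)
      moreover have "0 \<le> \<bar>a\<bar> * \<bar>b\<bar>"
        by simp
      ultimately show ?thesis
        unfolding abs_mult by linarith
    qed
    then show "AE w in P. norm (X i w $ j * X i w $ k) \<le> norm ((X i w $ j)\<^sup>2 + (X i w $ k)\<^sup>2)"
      by simp
  qed
  then show ?thesis
    using jk by (auto simp: Sigma_hat_def intro!: Bochner_Integration.integrable_sum integrable_divide)
qed

text \<open>The form of the expected matrix is the expectation of the empirical forms, which are
  nonnegative; integrability of the entries justifies exchanging the integral with the finite
  sums.\<close>

lemma pos_semidef_Sigma_pop:
  assumes "\<And>i j. i < n \<Longrightarrow> j < d \<Longrightarrow> (\<lambda>w. X i w $ j) \<in> borel_measurable P"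
    and "\<And>i j. i < n \<Longrightarrow> j < d \<Longrightarrow> integrable P (\<lambda>w. (X i w $ j)\<^sup>2)"
  shows "pos_semidef (Sigma_pop P d n X)"
  unfolding pos_semidef_def
proof (intro conjI ballI)
  have "Sigma_hat d n X w $$ (j, k) = Sigma_hat d n X w $$ (k, j)" if "j < d" "k < d" for w j k
    using that by (simp add: Sigma_hat_def mult.commute)
  then show "(Sigma_pop P d n X)\<^sup>T = Sigma_pop P d n X"
    by (intro eq_matI) (auto simp: Sigma_pop_def)
  fix x :: "real vec"
  assume "x \<in> carrier_vec (dim_col (Sigma_pop P d n X))"
  then have x: "x \<in> carrier_vec d"
    by (simp add: Sigma_pop_def)
  note int = integrable_Sigma_hat_index[of n d X P, OF assms]
  have "x \<bullet> (Sigma_pop P d n X *\<^sub>v x)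
      = (\<Sum>j<d. \<Sum>k<d. x $ j * (\<integral>w. Sigma_hat d n X w $$ (j, k) \<partial>P) * x $ k)"
    unfolding quadratic_form_sum[OF Sigma_pop_carrier x] by (simp add: Sigma_pop_def)
  also have "\<dots> = (\<Sum>j<d. \<Sum>k<d. \<integral>w. x $ j * Sigma_hat d n X w $$ (j, k) * x $ k \<partial>P)"
    by simp
  also have "\<dots> = (\<Sum>j<d. \<integral>w. (\<Sum>k<d. x $ j * Sigma_hat d n X w $$ (j, k) * x $ k) \<partial>P)"
    using int by (intro sum.cong refl Bochner_Integration.integral_sum[symmetric]) auto
  also have "\<dots> = (\<integral>w. (\<Sum>j<d. \<Sum>k<d. x $ j * Sigma_hat d n X w $$ (j, k) * x $ k) \<partial>P)"
    using int by (intro Bochner_Integration.integral_sum[symmetric] Bochner_Integration.integrable_sum) auto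
  also have "0 \<le> \<dots>"
    by (intro Bochner_Integration.integral_nonneg Sigma_hat_quadratic_form_nonneg)
  finally show "0 \<le> x \<bullet> (Sigma_pop P d n X *\<^sub>v x)" .
qed (simp add: Sigma_pop_def)

lemma invertible_mat_mult_vec_eq_0:
  assumes A: "A \<in> carrier_mat n n" "invertible_mat A" and x: "x \<in> carrier_vec n" "A *\<^sub>v x = 0\<^sub>v n"
  shows "x = 0\<^sub>v n"
proof -
  obtain B where B: "A * B = 1\<^sub>m n" "B * A = 1\<^sub>m (dim_row B)"
    using A by (auto simp: invertible_mat_def inverts_mat_def)
  \<comment> \<open>\<open>invertible_mat\<close> does not fix the shape of the inverse; it is read
    off by comparing column counts in the two identities.\<close>
  have "dim_col B = n" "dim_row B = n"
    using arg_cong[OF B(1), of dim_col] arg_cong[OF B(2), of dim_col] A by simp_all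
  then have "B \<in> carrier_mat n n"
    by auto
  then have "x = B *\<^sub>v (A *\<^sub>v x)"
    using A x(1) B(2) by (simp flip: assoc_mult_mat_vec[of B n n A n x])
  also have "\<dots> = 0\<^sub>v n"
    using x(2) mult_mat_vec_zero[OF \<open>B \<in> carrier_mat n n\<close>] by simp
  finally show ?thesis .
qed

text \<open>Along the line \<open>b + t h\<close> the increase of the objective is a nonnegative
  quadratic in \<open>t\<close> without constant term. The discriminant inequality forces its linear
  coefficient to vanish, with no differentiation.\<close>

lemma least_squares_orthogonality:
  assumes x: "\<And>i. i < n \<Longrightarrow> x i \<in> carrier_vec m"
    and min: "is_arg_min (\<lambda>\<theta>. \<Sum>i<n. (y i - x i \<bullet> \<theta>)\<^sup>2 :: real) (\<lambda>\<theta>. \<theta> \<in> carrier_vec m) b"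
    and h: "h \<in> carrier_vec m"
  shows "(\<Sum>i<n. (y i - x i \<bullet> b) * (x i \<bullet> h)) = 0"
proof -
  have b: "b \<in> carrier_vec m"
    using min by (simp add: is_arg_min_def)
  let ?c = "\<Sum>i<n. (y i - x i \<bullet> b) * (x i \<bullet> h)"
  let ?q = "\<Sum>i<n. (x i \<bullet> h)\<^sup>2"
  have "(- ?c)\<^sup>2 \<le> 0 * ?q"
  proof (rule quadratic_nonneg_imp_discriminant)
    fix t :: real
    have "(\<Sum>i<n. (y i - x i \<bullet> b)\<^sup>2) \<le> (\<Sum>i<n. (y i - x i \<bullet> (b + t \<cdot>\<^sub>v h))\<^sup>2)"
      using min b h unfolding is_arg_min_linorder by simp
    also have "\<dots> = (\<Sum>i<n. (y i - x i \<bullet> b)\<^sup>2 - 2 * t * ((y i - x i \<bullet> b) * (x i \<bullet> h)) + t\<^sup>2 * (x i \<bullet> h)\<^sup>2)"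
      using x b h by (intro sum.cong refl)
        (simp add: scalar_prod_add_distrib[of _ m] power2_eq_square algebra_simps)
    also have "\<dots> = (\<Sum>i<n. (y i - x i \<bullet> b)\<^sup>2) - 2 * t * ?c + t\<^sup>2 * ?q"
      by (simp add: sum.distrib sum_subtractf sum_distrib_left)
    finally show "0 \<le> 0 + 2 * t * - ?c + t\<^sup>2 * ?q"
      by simp
  qed (simp add: sum_nonneg)
  then show ?thesis
    by simp
qed

text \<open>Orthogonality of the residuals, tested in each coordinate direction and divided by
  \<open>n\<close>.\<close>

lemma normal_equations:
  assumes X: "\<And>i. i < n \<Longrightarrow> X i w \<in> carrier_vec d" and M: "M \<subseteq> {..<d}"
    and b: "is_beta_hat n X Y M w b"
  shows "submatrix (Sigma_hat d n X w) M M *\<^sub>v b = subvec (Gamma_hat d n X Y w) M"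
proof (rule eq_vecI)
  let ?S = "submatrix (Sigma_hat d n X w) M M" and ?G = "subvec (Gamma_hat d n X Y w) M"
  have S: "?S \<in> carrier_mat (card M) (card M)"
    by (rule submatrix_carrier[OF Sigma_hat_carrier M])
  have G: "?G \<in> carrier_vec (card M)"
    by (rule subvec_carrier[OF Gamma_hat_carrier M])
  have bc: "b \<in> carrier_vec (card M)"
    using b by (simp add: is_beta_hat_def is_arg_min_def)
  have fin: "finite M"
    using M finite_subset by blast
  have pick_less: "pick M k < d" if "k < card M" for k
    using bij_betw_apply[OF bij_betw_pick[OF fin]] that M by auto
  show "dim_vec (?S *\<^sub>v b) = dim_vec ?G"
    using S G by auto
  fix k
  assume "k < dim_vec ?G"
  then have k: "k < card M"
    using G by auto
  have x: "subvec (X i w) M \<in> carrier_vec (card M)" if "i < n" for i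
    using that X M by (auto intro: subvec_carrier)
  have xb: "subvec (X i w) M \<bullet> b = (\<Sum>l<card M. X i w $ pick M l * b $ l)" if "i < n" for i
    using bc subvec_index[OF X[OF that] M] by (auto simp: scalar_prod_def lessThan_atLeast0 intro!: sum.cong)
  \<comment> \<open>The \<open>k\<close>-th unit vector selects the regressor with index
    \<open>pick M k\<close>.\<close>
  have "(\<Sum>i<n. (Y i w - subvec (X i w) M \<bullet> b) * (subvec (X i w) M \<bullet> unit_vec (card M) k)) = 0"
    using b x by (intro least_squares_orthogonality[where m = "card M"]) (auto simp: is_beta_hat_def)
  then have "(\<Sum>i<n. (Y i w - subvec (X i w) M \<bullet> b) * X i w $ pick M k) = 0"
    using x k by (simp add: subvec_index[OF X M k])
  then have orth: "(\<Sum>i<n. X i w $ pick M k * (subvec (X i w) M \<bullet> b)) = (\<Sum>i<n. X i w $ pick M k * Y i w)"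
    by (simp add: algebra_simps sum_subtractf)
  have "(?S *\<^sub>v b) $ k = (\<Sum>l<card M. (\<Sum>i<n. X i w $ pick M k * X i w $ pick M l) / real n * b $ l)"
    unfolding mult_mat_vec_index_sum[OF S bc k]
    using k pick_less by (intro sum.cong refl) (simp add: submatrix_index_pick[OF Sigma_hat_carrier M], simp add: Sigma_hat_def)
  also have "\<dots> = (\<Sum>l<card M. \<Sum>i<n. X i w $ pick M k * (X i w $ pick M l * b $ l) / real n)"
    unfolding sum_distrib_right sum_divide_distrib by (simp add: mult_ac)
  also have "\<dots> = (\<Sum>i<n. X i w $ pick M k * (subvec (X i w) M \<bullet> b)) / real n"
    by (subst sum.swap) (simp add: xb sum_distrib_left sum_divide_distrib)
  also have "\<dots> = ?G $ k"
    unfolding orth using k pick_less by (simp add: subvec_index[OF Gamma_hat_carrier M], simp add: Gamma_hat_def)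
  finally show "(?S *\<^sub>v b) $ k = ?G $ k" .
qed

text \<open>The deterministic core: \<open>B\<close> is to be a realised empirical submatrix and
  \<open>u\<close> the difference of the two coefficient vectors, which makes \<open>r\<close> the
  linear term.\<close>

lemma linearization_error_bound:
  assumes A: "A \<in> carrier_mat m m" "pos_def A" and B: "B \<in> carrier_mat m m" and u: "u \<in> carrier_vec m"
  defines "R \<equiv> mat_inv (mat_sqrt A)"
  defines "D \<equiv> op_norm (R * B * R - 1\<^sub>m m)"
  defines "r \<equiv> mat_inv A *\<^sub>v (B *\<^sub>v u)"
  shows "ereal (weighted_norm A (u - r)) \<le> ratio_bound D (weighted_norm A r)"
proof -
  define S where "S = mat_sqrt A"
  note sqrt = mat_sqrt_pos_def[OF A, folded S_def]
  note inv = mat_inv_pos_def[OF A]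
  note invS = mat_inv_pos_def[OF sqrt(1,2), folded R_def[folded S_def]]
  define E where "E = R * B * R - 1\<^sub>m m"
  have E: "E \<in> carrier_mat m m"
    unfolding E_def by (rule minus_carrier_mat) simp
  have symS: "S\<^sup>T = S"
    using sqrt(2) by (simp add: pos_def_def pos_semidef_def)
  have norm: "weighted_norm A v = eucl_norm (S *\<^sub>v v)" if v: "v \<in> carrier_vec m" for v
  proof -
    have "A *\<^sub>v v = S *\<^sub>v (S *\<^sub>v v)"
      using sqrt(1,3) v by (simp flip: assoc_mult_mat_vec[of S m m S m v])
    then have "v \<bullet> (A *\<^sub>v v) = (S *\<^sub>v v) \<bullet> (S *\<^sub>v v)"
      using sqrt(1) symS v by (simp add: symmetric_scalar_prod[of S m])
    then show ?thesis
      by (simp add: weighted_norm_def eucl_norm_def)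
  qed
  have Bu: "B *\<^sub>v u \<in> carrier_vec m" and Su: "S *\<^sub>v u \<in> carrier_vec m"
    using B sqrt(1) u by auto
  have r: "r \<in> carrier_vec m"
    using inv Bu by (auto simp: r_def)
  have cancel: "R *\<^sub>v (S *\<^sub>v v) = v" if "v \<in> carrier_vec m" for v
    using that invS sqrt(1) by (simp flip: assoc_mult_mat_vec[of R m m S m v])
  have Sr: "S *\<^sub>v r = S *\<^sub>v u + E *\<^sub>v (S *\<^sub>v u)"
  proof -
    have "S *\<^sub>v (S *\<^sub>v r) = A *\<^sub>v r"
      using sqrt(1,3) r by (simp flip: assoc_mult_mat_vec[of S m m S m r])
    also have "\<dots> = B *\<^sub>v u"
      using inv A Bu by (simp add: r_def flip: assoc_mult_mat_vec[of A m m "mat_inv A" m "B *\<^sub>v u"])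
    \<comment> \<open>Applying \<open>R\<close> cancels one of the two factors \<open>S\<close>;
      below, \<open>R S = 1\<close> is inserted in front of \<open>u\<close>.\<close>
    finally have "S *\<^sub>v r = R *\<^sub>v (B *\<^sub>v u)"
      using cancel[of "S *\<^sub>v r"] sqrt(1) r by simp
    also have "\<dots> = R * B * R *\<^sub>v (S *\<^sub>v u)"
      using invS(1) B Su u cancel by (simp add: assoc_mult_mat_vec[of _ m m _ m])
    also have "\<dots> = S *\<^sub>v u + E *\<^sub>v (S *\<^sub>v u)"
    proof -
      have "R * B * R \<in> carrier_mat m m"
        using invS(1) B by simp
      then have "E *\<^sub>v (S *\<^sub>v u) = R * B * R *\<^sub>v (S *\<^sub>v u) - S *\<^sub>v u"
        unfolding E_def using Su by (subst minus_mult_distrib_mat_vec[of _ m m]) auto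
      then show ?thesis
        using Su \<open>R * B * R \<in> carrier_mat m m\<close> invS(1) sqrt(1) by (intro eq_vecI) auto
    qed
    finally show ?thesis .
  qed
  have ESu: "E *\<^sub>v (S *\<^sub>v u) \<in> carrier_vec m"
    using E Su by simp
  have bound: "eucl_norm (E *\<^sub>v (S *\<^sub>v u)) \<le> D * eucl_norm (S *\<^sub>v u)"
    using eucl_norm_mult_le_op_norm[of "S *\<^sub>v u" E] E Su by (simp add: D_def E_def[symmetric])
  have minus: "eucl_norm ((- 1) \<cdot>\<^sub>v (E *\<^sub>v (S *\<^sub>v u))) = eucl_norm (E *\<^sub>v (S *\<^sub>v u))"
    by (simp add: eucl_norm_smult)
  have "S *\<^sub>v (u - r) = (- 1) \<cdot>\<^sub>v (E *\<^sub>v (S *\<^sub>v u))"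
  proof -
    have "S *\<^sub>v (u - r) = S *\<^sub>v u - S *\<^sub>v r"
      using sqrt(1) u r by (rule mult_minus_distrib_mat_vec)
    then show ?thesis
      using Sr Su ESu by (intro eq_vecI) auto
  qed
  then have lhs: "weighted_norm A (u - r) \<le> D * eucl_norm (S *\<^sub>v u)"
    using norm[of "u - r"] u r minus bound by simp
  have "S *\<^sub>v u = S *\<^sub>v r + (- 1) \<cdot>\<^sub>v (E *\<^sub>v (S *\<^sub>v u))"
    using Sr Su ESu sqrt(1) E by (intro eq_vecI) auto
  then have "eucl_norm (S *\<^sub>v u) \<le> eucl_norm (S *\<^sub>v r) + eucl_norm (E *\<^sub>v (S *\<^sub>v u))"
    using eucl_norm_add_le[of "S *\<^sub>v r" m "(- 1) \<cdot>\<^sub>v (E *\<^sub>v (S *\<^sub>v u))"] sqrt(1) r ESu minus by simp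
  then have rhs: "(1 - D) * eucl_norm (S *\<^sub>v u) \<le> weighted_norm A r"
    using bound norm[OF r] by (simp add: algebra_simps)
  \<comment> \<open>For \<open>D \<ge> 1\<close> the bound is infinite; otherwise
    \<open>1 - D\<close> is positive and can be divided by.\<close>
  show ?thesis
  proof (cases "D \<ge> 1")
    case False
    then have "eucl_norm (S *\<^sub>v u) \<le> weighted_norm A r / (1 - D)"
      using rhs by (simp add: field_simps)
    then have "D * eucl_norm (S *\<^sub>v u) \<le> D * (weighted_norm A r / (1 - D))"
      by (rule mult_left_mono) (simp add: D_def op_norm_nonneg)
    then show ?thesis
      using False lhs by (simp add: ratio_bound_def)
  qed (simp add: ratio_bound_def)
qed

theorem corollary4p1:
  fixes P :: "'w measure"
    and d n :: nat
    and X :: "nat \<Rightarrow> 'w \<Rightarrow> real vec"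
    and Y :: "nat \<Rightarrow> 'w \<Rightarrow> real"
    and beta_hat :: "nat set \<Rightarrow> 'w \<Rightarrow> real vec"
    and beta :: "nat set \<Rightarrow> real vec"
  defines "\<Sigma> \<equiv> Sigma_pop P d n X"
    and "Sh \<equiv> Sigma_hat d n X"
    and "Gh \<equiv> Gamma_hat d n X Y"
  assumes "prob_space P"
    and "n \<ge> 1"
    and "\<And>i w. i < n \<Longrightarrow> w \<in> space P \<Longrightarrow> X i w \<in> carrier_vec d"
    and "\<And>i j. i < n \<Longrightarrow> j < d \<Longrightarrow> (\<lambda>w. X i w $ j) \<in> borel_measurable P"
    and "\<And>i. i < n \<Longrightarrow> Y i \<in> borel_measurable P"
    and "\<And>i j. i < n \<Longrightarrow> j < d \<Longrightarrow> integrable P (\<lambda>w. (X i w $ j)\<^sup>2)"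
    and "\<And>i. i < n \<Longrightarrow> integrable P (\<lambda>w. (Y i w)\<^sup>2)"
    and "invertible_mat \<Sigma>"
    and "\<And>M w. M \<subseteq> {..<d} \<Longrightarrow> M \<noteq> {} \<Longrightarrow> w \<in> space P \<Longrightarrow> is_beta_hat n X Y M w (beta_hat M w)"
    and "\<And>M. M \<subseteq> {..<d} \<Longrightarrow> M \<noteq> {} \<Longrightarrow> is_beta P n X Y M (beta M)"
  shows "(\<forall>Mh :: 'w \<Rightarrow> nat set. (\<forall>w \<in> space P. Mh w \<subseteq> {..<d} \<and> Mh w \<noteq> {}) \<longrightarrow>
            (\<forall>w \<in> space P.
               ereal (weighted_norm (submatrix \<Sigma> (Mh w) (Mh w))
                 (beta_hat (Mh w) w - beta (Mh w) - lin_term \<Sigma> (Sh w) (Gh w) (Mh w) (beta (Mh w))))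
               \<le> ratio_bound (D_dev \<Sigma> (Sh w) (Mh w))
                   (weighted_norm (submatrix \<Sigma> (Mh w) (Mh w))
                      (lin_term \<Sigma> (Sh w) (Gh w) (Mh w) (beta (Mh w))))))
       \<and> (\<forall>w \<in> space P. \<forall>M. M \<subseteq> {..<d} \<and> M \<noteq> {} \<longrightarrow>
            ereal (weighted_norm (submatrix \<Sigma> M M)
              (beta_hat M w - beta M - lin_term \<Sigma> (Sh w) (Gh w) M (beta M)))
            \<le> ratio_bound (D_dev \<Sigma> (Sh w) M)
                (weighted_norm (submatrix \<Sigma> M M) (lin_term \<Sigma> (Sh w) (Gh w) M (beta M))))"
proof -
  have \<Sigma>: "\<Sigma> \<in> carrier_mat d d" "pos_def \<Sigma>"
  proof -
    show "\<Sigma> \<in> carrier_mat d d"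
      by (simp add: \<Sigma>_def)
    have "pos_semidef \<Sigma>"
      unfolding \<Sigma>_def by (rule pos_semidef_Sigma_pop) (use assms(7,9) in auto)
    \<comment> \<open>Semidefiniteness holds as for any second moment matrix; invertibility upgrades
      it to definiteness.\<close>
    then show "pos_def \<Sigma>"
      using \<open>\<Sigma> \<in> carrier_mat d d\<close> \<open>invertible_mat \<Sigma>\<close> invertible_mat_mult_vec_eq_0
      by (blast intro: pos_semidef_nonsingular_imp_pos_def)
  qed
  \<comment> \<open>The inequality holds outcome by outcome and for every \<open>M\<close>, so a
    data-dependent selection is the instance \<open>M = Mh w\<close>.\<close>
  have main: "ereal (weighted_norm (submatrix \<Sigma> M M)
        (beta_hat M w - beta M - lin_term \<Sigma> (Sh w) (Gh w) M (beta M)))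
      \<le> ratio_bound (D_dev \<Sigma> (Sh w) M)
          (weighted_norm (submatrix \<Sigma> M M) (lin_term \<Sigma> (Sh w) (Gh w) M (beta M)))"
    if w: "w \<in> space P" and M: "M \<subseteq> {..<d}" "M \<noteq> {}" for w M
  proof -
    have bh: "is_beta_hat n X Y M w (beta_hat M w)" and b: "is_beta P n X Y M (beta M)"
      using assms(12,13) w M by auto
    have carr: "beta_hat M w \<in> carrier_vec (card M)" "beta M \<in> carrier_vec (card M)"
      using bh b by (simp_all add: is_beta_hat_def is_beta_def is_arg_min_def)
    have Sh: "submatrix (Sh w) M M \<in> carrier_mat (card M) (card M)"
      unfolding Sh_def by (rule submatrix_carrier[OF Sigma_hat_carrier M(1)])
    have "submatrix (Sh w) M M *\<^sub>v beta_hat M w = subvec (Gh w) M"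
      unfolding Sh_def Gh_def using assms(6) w M bh by (intro normal_equations) auto
    \<comment> \<open>By the normal equations the score at \<open>beta M\<close> is the empirical
      submatrix applied to the estimation error, which is the shape \<open>B u\<close> of the
      deterministic bound.\<close>
    then have "subvec (Gh w) M - submatrix (Sh w) M M *\<^sub>v beta M
        = submatrix (Sh w) M M *\<^sub>v (beta_hat M w - beta M)"
      using mult_minus_distrib_mat_vec[OF Sh carr] by simp
    then show ?thesis
      using linearization_error_bound[OF submatrix_carrier[OF \<Sigma>(1) M(1)] pos_def_submatrix[OF \<Sigma> M(1)] Sh,
          of "beta_hat M w - beta M"] carr
      by (simp add: lin_term_def D_dev_def Let_def)
  qed
  then show ?thesis
    by blast
qed

end
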